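(* Let $\delta=\mathbf{u}-\mathbf{v}=(0,1,-1)$ and let $\sigma$ be the linear subspace of $\mathbb{T}=\mathbb{R}^3$ spanned by the vectors $\mathbf{1}_{\mathbb{T}}$ and $\delta$. Let $\boxtimes$ be the restriction of $\otimes$ to $\sigma$, and let $$\mathbf{j}_{\mathbb{T}}=\tfrac13\mathbf{1}_{\mathbb{T}}+\tfrac23\delta=\tfrac13\left(\mathbf{1}_{\mathbb{T}}+2\mathbf{u}-2\mathbf{v}\right).$$ Then $\sigma$ is a subalgebra of the algebra $\mathbb{T}$, and the operation $\boxtimes$ is a hyperbolic complex multiplication on the plane $\sigma$ with "real" unit $\mathbf{1}_{\mathbb{T}}$ and "imaginary" unit $\mathbf{j}_{\mathbb{T}}$; that is, $\mathbf{j}_{\mathbb{T}}\boxtimes\mathbf{j}_{\mathbb{T}}=\mathbf{1}_{\mathbb{T}}$.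
   Context: $\mathbb{T}$ denotes the real vector space $\mathbb{R}^3$ with basis $\mathbf{1}_{\mathbb{T}}=(1,0,0)$, $\mathbf{u}=(0,1,0)$, $\mathbf{v}=(0,0,1)$ and multiplication $$(X_1,X_u,X_v)\otimes(Y_1,Y_u,Y_v)=\big(X_1Y_1-X_uY_v-X_vY_u,\; X_1Y_u+X_uY_1-X_vY_v,\; X_1Y_v+X_uY_u+X_vY_1\big).$$ It is a commutative associative real algebra with identity $\mathbf{1}_{\mathbb{T}}$. A subalgebra is a subset closed under addition, multiplication and scalar multiplication. Hyperbolic (Clifford) complex numbers are the numbers $a+b\jmath$ with $a,b\in\mathbb{R}$ and $\jmath^2=1$ ($\jmath\neq\pm1$), i.e. the two-dimensional real algebra with basis $1,\jmath$ and multiplication $(a+b\jmath)(c+d\jmath)=(ac+bd)+(ad+bc)\jmath$. That $\boxtimes$ is a hyperbolic complex multiplication on $\sigma$ with real unit $\mathbf{1}_{\mathbb{T}}$ and imaginary unit $\mathbf{j}_{\mathbb{T}}$ means that $\mathbf{1}_{\mathbb{T}},\mathbf{j}_{\mathbb{T}}$ form a basis of $\sigma$ in which $\boxtimes$ is given by this rule, with $1\mapsto\mathbf{1}_{\mathbb{T}}$ and $\jmath\mapsto\mathbf{j}_{\mathbb{T}}$. *)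

theory Defs
  imports "HOL-Analysis.Analysis"
begin

(* The algebra T is the vector space real^3; the components $1, $2, $3 are the
   coordinates with respect to the basis 1_T, u, v. *)

definition one_T :: "real^3" where "one_T = vector [1, 0, 0]"
definition u_T :: "real^3" where "u_T = vector [0, 1, 0]"
definition v_T :: "real^3" where "v_T = vector [0, 0, 1]"

definition mult_T :: "real^3 \<Rightarrow> real^3 \<Rightarrow> real^3" (infixl "\<otimes>\<^sub>T" 70) where
  "X \<otimes>\<^sub>T Y = vector
     [X$1 * Y$1 - X$2 * Y$3 - X$3 * Y$2,
      X$1 * Y$2 + X$2 * Y$1 - X$3 * Y$3,
      X$1 * Y$3 + X$2 * Y$2 + X$3 * Y$1]"

definition subalgebra_T :: "(real^3) set \<Rightarrow> bool" where
  "subalgebra_T S \<longleftrightarrow> subspace S \<and> (\<forall>X\<in>S. \<forall>Y\<in>S. X \<otimes>\<^sub>T Y \<in> S)"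

(* The pair (a, b) stands for the hyperbolic number a + b j, where j^2 = 1. *)
definition hyp_mult :: "real \<times> real \<Rightarrow> real \<times> real \<Rightarrow> real \<times> real" where
  "hyp_mult z w = (fst z * fst w + snd z * snd w, fst z * snd w + snd z * fst w)"

definition hyp_embed :: "'a::real_vector \<Rightarrow> 'a \<Rightarrow> real \<times> real \<Rightarrow> 'a" where
  "hyp_embed e j z = fst z *\<^sub>R e + snd z *\<^sub>R j"

(* The condition e \<noteq> j is needed because the set {e, j} collapses when e = j. *)
definition hyperbolic_multiplication_on ::
    "'a::real_vector set \<Rightarrow> ('a \<Rightarrow> 'a \<Rightarrow> 'a) \<Rightarrow> 'a \<Rightarrow> 'a \<Rightarrow> bool" where
  "hyperbolic_multiplication_on S m e j \<longleftrightarrow>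
     e \<noteq> j \<and> independent {e, j} \<and> span {e, j} = S \<and>
     (\<forall>z w. m (hyp_embed e j z) (hyp_embed e j w) = hyp_embed e j (hyp_mult z w))"

definition delta_T :: "real^3" where "delta_T = u_T - v_T"

definition sigma_T :: "(real^3) set" where "sigma_T = span {one_T, delta_T}"

(* The restriction of the multiplication: it is undefined outside sigma_T. *)
definition mult_sigma :: "real^3 \<Rightarrow> real^3 \<Rightarrow> real^3" (infixl "\<boxtimes>" 70) where
  "mult_sigma = (\<lambda>X\<in>sigma_T. \<lambda>Y\<in>sigma_T. X \<otimes>\<^sub>T Y)"

definition j_T :: "real^3" where "j_T = (1/3) *\<^sub>R one_T + (2/3) *\<^sub>R delta_T"

end

theory Submission
  imports Defs
begin

text \<open>In the algebra, \<open>delta_T\<close> squares to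
  \<open>2 *\<^sub>R one_T - delta_T\<close>. Completing the square makes the square of
  \<open>delta_T + (1/2) *\<^sub>R one_T\<close> equal to 9/4 times the unit, and rescaling by 2/3
  gives \<open>j_T\<close>, a square root of the unit. Since \<open>one_T\<close> and
  \<open>j_T\<close> also span the plane, \<open>sigma_T\<close> is the image of the hyperbolic
  numbers under \<open>hyp_embed one_T j_T\<close> (\<open>sigma_T_eq_range\<close>), and
  \<open>mult_T_hyp_embed\<close> carries the product over.\<close>

lemma delta_T_eq: "delta_T = vector [0, 1, -1]"
  by (simp add: delta_T_def u_T_def v_T_def vec_eq_iff forall_3)

lemma span_one_j: "span {one_T, j_T} = sigma_T"
proof (rule antisym)
  have "j_T \<in> sigma_T"
    unfolding j_T_def sigma_T_def by (intro span_add span_scale span_base) auto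
  moreover have "one_T \<in> sigma_T"
    unfolding sigma_T_def by (intro span_base) auto
  ultimately show "span {one_T, j_T} \<subseteq> sigma_T"
    unfolding sigma_T_def by (intro span_minimal) auto
  \<comment> \<open>The definition of \<open>j_T\<close>, solved for \<open>delta_T\<close>.\<close>
  have "delta_T = (3/2) *\<^sub>R j_T - (1/2) *\<^sub>R one_T"
    by (simp add: j_T_def algebra_simps)
  also have "\<dots> \<in> span {one_T, j_T}"
    by (intro span_diff span_scale span_base) auto
  finally show "sigma_T \<subseteq> span {one_T, j_T}"
    unfolding sigma_T_def by (intro span_minimal) (auto intro: span_base)
qed

text \<open>Turns closure of the plane under products into a statement about hyperbolic
  numbers.\<close>

lemma sigma_T_eq_range: "sigma_T = range (hyp_embed one_T j_T)"
  unfolding span_one_j [symmetric] span_insert span_singleton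
  by (auto simp: hyp_embed_def image_iff algebra_simps) blast

lemma hyp_embed_one_j: "hyp_embed one_T j_T (a, b) = vector [a + b / 3, 2 * b / 3, - 2 * b / 3]"
  by (simp add: hyp_embed_def j_T_def delta_T_eq one_T_def vec_eq_iff forall_3)

text \<open>A polynomial identity in the four real coefficients, checked coordinatewise.\<close>

lemma mult_T_hyp_embed:
  "hyp_embed one_T j_T z \<otimes>\<^sub>T hyp_embed one_T j_T w = hyp_embed one_T j_T (hyp_mult z w)"
  by (cases z; cases w)
    (simp add: hyp_embed_one_j hyp_mult_def mult_T_def vec_eq_iff forall_3 field_simps)

text \<open>Both factors lie in \<open>sigma_T\<close>, so the restriction takes its defined
  value.\<close>

lemma mult_sigma_hyp_embed:
  "hyp_embed one_T j_T z \<boxtimes> hyp_embed one_T j_T w = hyp_embed one_T j_T (hyp_mult z w)"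
  by (simp add: mult_sigma_def sigma_T_eq_range mult_T_hyp_embed)

lemma independent_one_j: "one_T \<noteq> j_T" "independent {one_T, j_T}"
proof -
  \<comment> \<open>The u-coordinate of \<open>j_T\<close> is 2/3 and that of \<open>one_T\<close>
    is 0, so only the multiple 0 could match.\<close>
  have "one_T \<notin> span {j_T}" "j_T \<noteq> 0"
    by (auto simp: span_singleton j_T_def delta_T_eq one_T_def vec_eq_iff forall_3)
  then show "independent {one_T, j_T}" "one_T \<noteq> j_T"
    by (auto simp: independent_insert span_base)
qed

lemma subalgebra_sigma_T: "subalgebra_T sigma_T"
proof -
  have "subspace sigma_T"
    by (simp add: sigma_T_def)
  then show ?thesis
    by (auto simp: subalgebra_T_def sigma_T_eq_range mult_T_hyp_embed)
qed

theorem theorem2: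
  shows "delta_T = vector [0, 1, -1]
    \<and> j_T = (1/3) *\<^sub>R (one_T + 2 *\<^sub>R u_T - 2 *\<^sub>R v_T)
    \<and> subalgebra_T sigma_T
    \<and> hyperbolic_multiplication_on sigma_T mult_sigma one_T j_T
    \<and> j_T \<boxtimes> j_T = one_T"
proof (intro conjI)
  show "delta_T = vector [0, 1, -1]"
    by (fact delta_T_eq)
  show "j_T = (1/3) *\<^sub>R (one_T + 2 *\<^sub>R u_T - 2 *\<^sub>R v_T)"
    by (simp add: j_T_def delta_T_def algebra_simps)
  show "subalgebra_T sigma_T"
    by (fact subalgebra_sigma_T)
  show "hyperbolic_multiplication_on sigma_T mult_sigma one_T j_T"
    by (simp add: hyperbolic_multiplication_on_def independent_one_j span_one_j
        mult_sigma_hyp_embed)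
  show "j_T \<boxtimes> j_T = one_T"
    \<comment> \<open>The pair \<open>(0, 1)\<close> embeds as \<open>j_T\<close>, and its
      hyperbolic square \<open>(1, 0)\<close> as \<open>one_T\<close>.\<close>
    using mult_sigma_hyp_embed [of "(0, 1)" "(0, 1)"]
    by (simp add: hyp_embed_def hyp_mult_def)
qed

end
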